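(* Let $\mathbb{G}$ be a stratified group with $N\ge 2$ the dimension of its first stratum, let $n\ge 3$, and let $\Omega\subset\mathbb{G}^n$ be an open set. Let $r_{ij}=|(x_ix_j^{-1})'|=|x'_i-x'_j|$ for $x=(x_1,\ldots,x_n)\in\mathbb{G}^n$. Then $$\int_\Omega|\nabla_{\mathbb{G}^n}u|^2\,dx\ \ge\ \frac{(N-2)^2}{n}\int_\Omega\sum_{1\le i<j\le n}\frac{|u|^2}{r_{ij}^2}\,dx$$ for all $u\in C^1(\Omega)$.
   Context: A stratified group (homogeneous Carnot group) $\mathbb{G}=(\mathbb{R}^d,\circ,\delta_\lambda)$ of step $r$ is a Lie group structure on $\mathbb{R}^d$, with points written $y=(y',y^{(2)},\ldots,y^{(r)})$, $y'=(y'_1,\ldots,y'_N)\in\mathbb{R}^N$ (the first stratum coordinates), $y^{(l)}=(y^{(l)}_1,\ldots,y^{(l)}_{N_l})\in\mathbb{R}^{N_l}$, such that the dilations $\delta_\lambda(y)=(\lambda y',\lambda^2y^{(2)},\ldots,\lambda^ry^{(r)})$, $\lambda>0$, are group automorphisms, and such that the left-invariant vector fields $X_1,\ldots,X_N$ with $X_k(0)=\partial/\partial y'_k|_0$ (the Jacobian generators of the first stratum) generate, together with their iterated commutators, the whole Lie algebra. Explicitly, $X_k=\frac{\partial}{\partial y'_k}+\sum_{l=2}^{r}\sum_{m=1}^{N_l}a^{(l)}_{k,m}(y',\ldots,y^{(l-1)})\frac{\partial}{\partial y^{(l)}_m}$. $\mathbb{G}^n=\mathbb{G}\times\cdots\times\mathbb{G}$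 ($n$ factors, $n$ an integer) with points $x=(x_1,\ldots,x_n)$, $x_i\in\mathbb{G}$ (the $i$-th particle), and $x'_i=(x'_{i1},\ldots,x'_{iN})$ the first stratum coordinates of $x_i$; one has $(x_ix_j^{-1})'=x'_i-x'_j$, and $|\cdot|$ is the Euclidean norm. $X_{ik}$ denotes the vector field $X_k$ acting in the variable $x_i$, $\nabla_{\mathbb{G}_i}=(X_{i1},\ldots,X_{iN})$, and $\nabla_{\mathbb{G}^n}=(\nabla_{\mathbb{G}_1},\ldots,\nabla_{\mathbb{G}_n})$. $dx$ is Lebesgue measure (Haar measure) on $\mathbb{G}^n$. $C^1(\Omega)$ denotes the continuously differentiable functions on $\Omega$.
   Formalization: The inequality is proved for u in C^1(Ω) with compact support in Ω instead of all u in C^1(Ω); without this it is false, e.g. G = R^3 abelian, n = 3, Ω the unit ball, u = 1 gives left side 0 and a positive right side. *)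

theory Defs
  imports "HOL-Analysis.Analysis"
begin

section \<open>Continuously differentiable functions\<close>

text \<open>
  Meant for open \<open>S\<close>.  In finite dimension, continuity of all directional derivatives
  \<open>x \<mapsto> Df(x) v\<close> is the same as continuity of \<open>x \<mapsto> Df(x)\<close> in operator norm.
\<close>

fun Ck_on :: "nat \<Rightarrow> ('a::real_normed_vector \<Rightarrow> 'b::real_normed_vector) \<Rightarrow> 'a set \<Rightarrow> bool" where
  "Ck_on 0 f S \<longleftrightarrow> continuous_on S f"
| "Ck_on (Suc k) f S \<longleftrightarrow>
     (\<forall>x\<in>S. f differentiable (at x)) \<and>
     (\<forall>v. Ck_on k (\<lambda>x. frechet_derivative f (at x) v) S)"

definition smooth_on :: "('a::real_normed_vector \<Rightarrow> 'b::real_normed_vector) \<Rightarrow> 'a set \<Rightarrow> bool" where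
  "smooth_on f S \<longleftrightarrow> (\<forall>k. Ck_on k f S)"

text \<open>
  Together with \<open>Ck_on 1 u \<Omega>\<close> this is the class \<open>C\<^sup>1\<^sub>0(\<Omega>)\<close>.  A Hardy inequality without remainder or
  boundary terms needs it: on a ball the constant function \<open>1\<close> has zero gradient.
  Only the values of \<open>u\<close> on \<open>\<Omega>\<close> matter; outside \<open>\<Omega>\<close> the function \<open>u\<close> is arbitrary.
\<close>

definition compact_support_in :: "('a::real_normed_vector \<Rightarrow> 'b::zero) \<Rightarrow> 'a set \<Rightarrow> bool" where
  "compact_support_in u \<Omega> \<longleftrightarrow> (\<exists>K. compact K \<and> K \<subseteq> \<Omega> \<and> (\<forall>x\<in>\<Omega> - K. u x = 0))"


section \<open>Vector fields on a Lie group with underlying manifold a vector space\<close>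

text \<open>A vector field is given by its coefficient function; the associated derivation is
  \<open>f \<mapsto> (x \<mapsto> Df(x) (X x))\<close>.\<close>

definition lie_bracket ::
  "('a::real_normed_vector \<Rightarrow> 'a) \<Rightarrow> ('a \<Rightarrow> 'a) \<Rightarrow> 'a \<Rightarrow> 'a" where
  "lie_bracket X Y x = frechet_derivative Y (at x) (X x) - frechet_derivative X (at x) (Y x)"

inductive_set lie_generated :: "('a::real_normed_vector \<Rightarrow> 'a) set \<Rightarrow> ('a \<Rightarrow> 'a) set"
  for G :: "('a \<Rightarrow> 'a) set" where
  base: "X \<in> G \<Longrightarrow> X \<in> lie_generated G"
| zero: "(\<lambda>x. 0) \<in> lie_generated G"
| add: "X \<in> lie_generated G \<Longrightarrow> Y \<in> lie_generated G \<Longrightarrow> (\<lambda>x. X x + Y x) \<in> lie_generated G"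
| scale: "X \<in> lie_generated G \<Longrightarrow> (\<lambda>x. c *\<^sub>R X x) \<in> lie_generated G"
| bracket: "X \<in> lie_generated G \<Longrightarrow> Y \<in> lie_generated G \<Longrightarrow> lie_bracket X Y \<in> lie_generated G"

definition left_invariant ::
  "('a::real_normed_vector \<Rightarrow> 'a \<Rightarrow> 'a) \<Rightarrow> ('a \<Rightarrow> 'a) \<Rightarrow> bool" where
  "left_invariant gmult X \<longleftrightarrow>
     (\<forall>x y. X (gmult x y) = frechet_derivative (gmult x) (at y) (X y))"

definition lie_algebra ::
  "('a::real_normed_vector \<Rightarrow> 'a \<Rightarrow> 'a) \<Rightarrow> ('a \<Rightarrow> 'a) set" where
  "lie_algebra gmult = {X. smooth_on X UNIV \<and> left_invariant gmult X}"


section \<open>Stratified groups\<close>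

text \<open>
  Coordinates of \<open>\<real>\<^sup>d\<close> are indexed by the finite type \<open>'d\<close>.  The division of a point into
  strata is encoded by a weight function: coordinate \<open>m\<close> belongs to \<open>y\<^sup>(\<^sup>l\<^sup>)\<close> iff \<open>w m = l\<close>.
\<close>

definition dilation :: "('d::finite \<Rightarrow> nat) \<Rightarrow> real \<Rightarrow> real ^ 'd \<Rightarrow> real ^ 'd" where
  "dilation w s y = (\<chi> m. s ^ w m * y $ m)"

definition first_stratum :: "('d::finite \<Rightarrow> nat) \<Rightarrow> 'd set" where
  "first_stratum w = {k. w k = 1}"

text \<open>The left-invariant field \<open>X\<^sub>k\<close> with \<open>X\<^sub>k(0) = \<partial>/\<partial>y\<^sub>k\<close>: its value at \<open>x\<close> is column \<open>k\<close> of the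
  Jacobian matrix at \<open>0\<close> of the left translation by \<open>x\<close>.\<close>

definition jacobian_generator ::
  "(real ^ 'd \<Rightarrow> real ^ 'd \<Rightarrow> real ^ 'd) \<Rightarrow> 'd::finite \<Rightarrow> real ^ 'd \<Rightarrow> real ^ 'd" where
  "jacobian_generator gmult k x = frechet_derivative (gmult x) (at 0) (axis k 1)"

text \<open>The identity element is the origin: as all weights are positive, \<open>0\<close> is the only point fixed
  by every dilation, so dilation invariance leaves no other choice.\<close>

locale stratified_group =
  fixes w :: "'d::finite \<Rightarrow> nat"
    and r :: nat
    and gmult :: "real ^ 'd \<Rightarrow> real ^ 'd \<Rightarrow> real ^ 'd"
    and ginv :: "real ^ 'd \<Rightarrow> real ^ 'd"
  assumes weights: "range w = {1..r}"
    and group_axioms: "group gmult 0 ginv"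
    and smooth_gmult: "smooth_on (\<lambda>p. gmult (fst p) (snd p)) UNIV"
    and smooth_ginv: "smooth_on ginv UNIV"
    and dilation_hom:
      "s > 0 \<Longrightarrow> dilation w s (gmult x y) = gmult (dilation w s x) (dilation w s y)"
    and generation: "lie_generated (jacobian_generator gmult ` first_stratum w) = lie_algebra gmult"


section \<open>Many particles\<close>

text \<open>A point of \<open>\<G>\<^sup>n\<close> is \<open>x :: (real ^ 'd) ^ 'n\<close>, with \<open>x $ i\<close> the position of particle \<open>i\<close>.\<close>

definition particle_dist ::
  "('d::finite \<Rightarrow> nat) \<Rightarrow> (real ^ 'd \<Rightarrow> real ^ 'd \<Rightarrow> real ^ 'd) \<Rightarrow> (real ^ 'd \<Rightarrow> real ^ 'd) \<Rightarrow>
   (real ^ 'd) ^ 'n::finite \<Rightarrow> 'n \<Rightarrow> 'n \<Rightarrow> real" where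
  "particle_dist w gmult ginv x i j =
     L2_set (\<lambda>k. gmult (x $ i) (ginv (x $ j)) $ k) (first_stratum w)"

text \<open>\<open>X\<^sub>i\<^sub>k u\<close>, the field \<open>X\<^sub>k\<close> acting in the variable \<open>x\<^sub>i\<close>.\<close>

definition particle_field ::
  "(real ^ 'd \<Rightarrow> real ^ 'd \<Rightarrow> real ^ 'd) \<Rightarrow> 'n::finite \<Rightarrow> 'd::finite \<Rightarrow>
   ((real ^ 'd) ^ 'n \<Rightarrow> complex) \<Rightarrow> (real ^ 'd) ^ 'n \<Rightarrow> complex" where
  "particle_field gmult i k u x =
     frechet_derivative u (at x) (axis i (jacobian_generator gmult k (x $ i)))"

definition horizontal_grad_norm ::
  "('d::finite \<Rightarrow> nat) \<Rightarrow> (real ^ 'd \<Rightarrow> real ^ 'd \<Rightarrow> real ^ 'd) \<Rightarrow>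
   ((real ^ 'd) ^ 'n::finite \<Rightarrow> complex) \<Rightarrow> (real ^ 'd) ^ 'n \<Rightarrow> real" where
  "horizontal_grad_norm w gmult u x =
     sqrt (\<Sum>i\<in>UNIV. \<Sum>k\<in>first_stratum w. (cmod (particle_field gmult i k u x))\<^sup>2)"

end

theory Submission
  imports Defs
begin

text \<open>
  Write \<open>X\<^sub>i\<^sub>k\<close> for the generator \<open>X\<^sub>k\<close> acting on particle \<open>i\<close>.  The inequality follows from a Hardy
  inequality for each pair of particles together with the elementary identity
  \<open>n \<Sum>\<^sub>i c\<^sub>i\<^sup>2 = \<Sum>\<^sub>i\<^sub><\<^sub>j (c\<^sub>i - c\<^sub>j)\<^sup>2 + (\<Sum>\<^sub>i c\<^sub>i)\<^sup>2\<close>, applied pointwise with \<open>c\<^sub>i = X\<^sub>i\<^sub>k u\<close>: it bounds \<open>n\<close> times the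
  horizontal energy from below by the energies of \<open>u\<close> along the relative fields
  \<open>X\<^sub>i\<^sub>k - X\<^sub>j\<^sub>k\<close> (\<open>sum_pairs_diff_sq_le\<close>).

  For one pair and real \<open>u\<close> (the real and imaginary parts are treated separately), let \<open>F\<^sub>k = (x\<^sub>i\<^sub>k - x\<^sub>j\<^sub>k) / (r\<^sub>i\<^sub>j\<^sup>2 + \<epsilon>)\<close> and \<open>\<alpha> = N - 2\<close>.  Expanding
  \<open>0 \<le> \<Sum>\<^sub>k ((X\<^sub>i\<^sub>k - X\<^sub>j\<^sub>k) u + \<alpha> F\<^sub>k u)\<^sup>2\<close> gives, up to terms \<open>(X\<^sub>i\<^sub>k - X\<^sub>j\<^sub>k) (F\<^sub>k u\<^sup>2)\<close>, a lower bound for the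
  relative energy density.  These terms integrate to zero because the fields are divergence free.
  Since \<open>X\<^sub>i\<^sub>k - X\<^sub>j\<^sub>k\<close> differentiates \<open>x\<^sub>i\<^sub>k - x\<^sub>j\<^sub>k\<close> to the constant 2, the rest of the computation is the
  Euclidean one and produces the constant \<open>2\<alpha>(N - 2) - \<alpha>\<^sup>2 = (N - 2)\<^sup>2\<close> (\<open>regularised_hardy\<close>,
  \<open>pair_hardy\<close>).  The regularisation makes every integrand continuous, and \<open>\<epsilon> \<rightarrow> 0\<close> is monotone
  convergence (\<open>nn_integral_singular_weight_le\<close>).

  The facts about the group come from homogeneity under the dilations.  A function that is homogeneous
  of degree one and differentiable at the origin is linear in the first stratum coordinates; this
  makes the group law additive there (\<open>gmult_first_stratum\<close>), identifies \<open>r\<^sub>i\<^sub>j\<close> with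
  \<open>|x'\<^sub>i - x'\<^sub>j|\<close>, and determines \<open>X\<^sub>k\<close> on first stratum coordinates.  The derivative of the \<open>m\<close>-th coefficient of
  \<open>X\<^sub>k\<close> in its own direction \<open>m\<close> is continuous and homogeneous of degree \<open>-1\<close>, hence zero
  (\<open>jacobian_generator_diagonal_derivative\<close>); so \<open>X\<^sub>k\<close> is divergence free.
\<close>

section \<open>Functions of class C1\<close>

abbreviation (input) dir_deriv ::
  "('a::real_normed_vector \<Rightarrow> 'b::real_normed_vector) \<Rightarrow> 'a \<Rightarrow> 'a \<Rightarrow> 'b" where
  "dir_deriv f x v \<equiv> frechet_derivative f (at x) v"

lemma Ck1_iff:
  "Ck_on 1 f S \<longleftrightarrow>
     (\<forall>x\<in>S. f differentiable (at x)) \<and> (\<forall>v. continuous_on S (\<lambda>x. dir_deriv f x v))"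
  by simp

lemma Ck1_has_derivative:
  "Ck_on 1 f UNIV \<Longrightarrow> (f has_derivative dir_deriv f x) (at x)"
  by (simp add: Ck1_iff frechet_derivative_works[symmetric])

lemma Ck1_continuous: "Ck_on 1 f UNIV \<Longrightarrow> continuous_on UNIV f"
  by (meson Ck1_has_derivative continuous_at_imp_continuous_on has_derivative_continuous)

lemma Ck1_I:
  assumes "\<And>x. (f has_derivative f' x) (at x)" and "\<And>v. continuous_on UNIV (\<lambda>x. f' x v)"
  shows "Ck_on 1 f UNIV"
proof -
  have "dir_deriv f x = f' x" for x
    using frechet_derivative_at[OF assms(1)] by simp
  with assms show ?thesis
    by (auto simp: Ck1_iff differentiable_def)
qed

lemma dir_deriv_eq: "(f has_derivative f') (at x) \<Longrightarrow> dir_deriv f x v = f' v"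
  using frechet_derivative_at by metis

lemma Ck1_mult:
  fixes f g :: "'a::real_normed_vector \<Rightarrow> real"
  assumes f: "Ck_on 1 f UNIV" and g: "Ck_on 1 g UNIV"
  shows "Ck_on 1 (\<lambda>x. f x * g x) UNIV"
    and "dir_deriv (\<lambda>x. f x * g x) x v = f x * dir_deriv g x v + dir_deriv f x v * g x"
proof -
  have d: "((\<lambda>x. f x * g x) has_derivative
      (\<lambda>v. f x * dir_deriv g x v + dir_deriv f x v * g x)) (at x)" for x
    using has_derivative_mult[OF Ck1_has_derivative[OF f] Ck1_has_derivative[OF g]] .
  show "dir_deriv (\<lambda>x. f x * g x) x v = f x * dir_deriv g x v + dir_deriv f x v * g x"
    by (rule dir_deriv_eq[OF d])
  have "continuous_on UNIV (\<lambda>x. dir_deriv f x v)" "continuous_on UNIV (\<lambda>x. dir_deriv g x v)" for v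
    using f g by (auto simp: Ck1_iff)
  then show "Ck_on 1 (\<lambda>x. f x * g x) UNIV"
    by (intro Ck1_I[OF d] continuous_intros Ck1_continuous[OF f] Ck1_continuous[OF g])
qed

lemma Ck1_diff:
  assumes f: "Ck_on 1 f UNIV" and g: "Ck_on 1 g UNIV"
  shows "Ck_on 1 (\<lambda>x. f x - g x) UNIV"
    and "dir_deriv (\<lambda>x. f x - g x) x v = dir_deriv f x v - dir_deriv g x v"
proof -
  have d: "((\<lambda>x. f x - g x) has_derivative (\<lambda>v. dir_deriv f x v - dir_deriv g x v)) (at x)" for x
    using has_derivative_diff[OF Ck1_has_derivative[OF f] Ck1_has_derivative[OF g]] .
  show "dir_deriv (\<lambda>x. f x - g x) x v = dir_deriv f x v - dir_deriv g x v"
    by (rule dir_deriv_eq[OF d])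
  have "continuous_on UNIV (\<lambda>x. dir_deriv f x v)" "continuous_on UNIV (\<lambda>x. dir_deriv g x v)" for v
    using f g by (auto simp: Ck1_iff)
  then show "Ck_on 1 (\<lambda>x. f x - g x) UNIV"
    by (intro Ck1_I[OF d] continuous_intros)
qed

lemma Ck1_linear_comp:
  assumes f: "Ck_on 1 f UNIV" and L: "bounded_linear L"
  shows "Ck_on 1 (\<lambda>x. L (f x)) UNIV"
    and "dir_deriv (\<lambda>x. L (f x)) x v = L (dir_deriv f x v)"
proof -
  have d: "((\<lambda>x. L (f x)) has_derivative (\<lambda>v. L (dir_deriv f x v))) (at x)" for x
    using bounded_linear.has_derivative[OF L Ck1_has_derivative[OF f]] .
  show "dir_deriv (\<lambda>x. L (f x)) x v = L (dir_deriv f x v)"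
    by (rule dir_deriv_eq[OF d])
  have "continuous_on UNIV (\<lambda>x. dir_deriv f x v)" for v
    using f by (auto simp: Ck1_iff)
  then show "Ck_on 1 (\<lambda>x. L (f x)) UNIV"
    by (intro Ck1_I[OF d] bounded_linear.continuous_on[OF L])
qed

lemma dir_deriv_linear:
  assumes "Ck_on 1 f UNIV" shows "linear (dir_deriv f x)"
  using Ck1_has_derivative[OF assms] has_derivative_linear by blast

lemma continuous_on_dir_deriv_along:
  fixes f :: "'a::euclidean_space \<Rightarrow> 'b::real_normed_vector"
  assumes f: "Ck_on 1 f UNIV" and Y: "continuous_on UNIV Y"
  shows "continuous_on UNIV (\<lambda>x. dir_deriv f x (Y x))"
proof -
  have "dir_deriv f x (Y x) = (\<Sum>b\<in>Basis. (Y x \<bullet> b) *\<^sub>R dir_deriv f x b)" for x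
  proof -
    interpret linear "dir_deriv f x" by (rule dir_deriv_linear[OF f])
    have "dir_deriv f x (Y x) = dir_deriv f x (\<Sum>b\<in>Basis. (Y x \<bullet> b) *\<^sub>R b)"
      by (simp add: euclidean_representation)
    then show ?thesis by (simp add: sum scale)
  qed
  moreover have "continuous_on UNIV (\<lambda>x. dir_deriv f x v)" for v
    using f by (auto simp: Ck1_iff)
  ultimately show ?thesis
    using Y by (auto intro!: continuous_intros)
qed

lemma bounded_linear_axis: "bounded_linear (axis i :: 'a::euclidean_space \<Rightarrow> 'a ^ 'n)"
  unfolding linear_conv_bounded_linear[symmetric]
  by (rule linearI) (auto simp: vec_eq_iff axis_def)

lemma Ck1_axis_field:
  fixes f :: "'a::euclidean_space \<Rightarrow> 'a" and i :: "'n::finite"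
  assumes f: "Ck_on 1 f UNIV"
  shows "Ck_on 1 (\<lambda>x. axis i (f (x $ i))) UNIV"
    and "dir_deriv (\<lambda>x. axis i (f (x $ i))) x v = axis i (dir_deriv f (x $ i) (v $ i))"
proof -
  have nth: "((\<lambda>x::'a^'n. x $ i) has_derivative (\<lambda>v. v $ i)) (at x)" for x
    by (rule bounded_linear_imp_has_derivative[OF bounded_linear_vec_nth])
  have d: "((\<lambda>x. axis i (f (x $ i))) has_derivative
      (\<lambda>v. axis i (dir_deriv f (x $ i) (v $ i)) :: 'a ^ 'n)) (at x)" for x
    by (rule bounded_linear.has_derivative[OF bounded_linear_axis
          has_derivative_compose[OF nth Ck1_has_derivative[OF f]]])
  show "dir_deriv (\<lambda>x. axis i (f (x $ i))) x v = axis i (dir_deriv f (x $ i) (v $ i))"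
    by (rule dir_deriv_eq[OF d])
  show "Ck_on 1 (\<lambda>x. axis i (f (x $ i))) UNIV"
  proof (rule Ck1_I[OF d])
    have "continuous_on UNIV (\<lambda>x. dir_deriv f x (v $ i))" for v :: "'a ^ 'n"
      using f by (simp add: Ck1_iff)
    then have "continuous_on UNIV (\<lambda>x::'a^'n. dir_deriv f (x $ i) (v $ i))" for v :: "'a ^ 'n"
      by (rule continuous_on_compose2) (auto intro!: continuous_intros)
    then show "continuous_on UNIV (\<lambda>x. axis i (dir_deriv f (x $ i) (v $ i)) :: 'a ^ 'n)" for v :: "'a ^ 'n"
      by (rule bounded_linear.continuous_on[OF bounded_linear_axis])
  qed
qed

text \<open>
  A function with compact support in \<open>\<Omega>\<close> can be taken to live on the whole space: \<open>\<Omega>\<close> and the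
  complement of the support are two open sets that cover it, and the extension is C1 on both.
\<close>

lemma Ck1_extend_by_zero:
  assumes "open \<Omega>" "Ck_on 1 u \<Omega>" and K: "compact K" "K \<subseteq> \<Omega>" "\<And>x. x \<in> \<Omega> - K \<Longrightarrow> u x = 0"
  defines "U \<equiv> \<lambda>x. if x \<in> \<Omega> then u x else 0"
  shows "Ck_on 1 U UNIV" and "\<And>x v. x \<in> \<Omega> \<Longrightarrow> dir_deriv U x v = dir_deriv u x v"
proof -
  have oK: "open (- K)" using K(1) by (simp add: compact_imp_closed open_Compl)
  have UK: "U x = 0" if "x \<notin> K" for x using that K(3) by (auto simp: U_def)
  have in_\<Omega>: "(U has_derivative dir_deriv u x) (at x)" if "x \<in> \<Omega>" for x
  proof (rule has_derivative_transform_within_open[of u _ x UNIV \<Omega>])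
    show "(u has_derivative dir_deriv u x) (at x)"
      using assms(2) that by (simp add: Ck1_iff frechet_derivative_works[symmetric])
  qed (use assms(1) that in \<open>auto simp: U_def\<close>)
  then show eq: "\<And>x v. x \<in> \<Omega> \<Longrightarrow> dir_deriv U x v = dir_deriv u x v"
    by (rule dir_deriv_eq)
  have off: "(U has_derivative (\<lambda>_. 0)) (at x)" if "x \<notin> K" for x
    using has_derivative_transform_within_open[of "\<lambda>_. 0" "\<lambda>_. 0" x UNIV "- K" U] oK that UK by auto
  show "Ck_on 1 U UNIV"
  proof (rule Ck1_I)
    show "(U has_derivative dir_deriv U x) (at x)" for x
      using in_\<Omega>[of x] off[of x] K(2) frechet_derivative_works differentiable_def by blast
    fix v
    have "continuous_on \<Omega> (\<lambda>x. dir_deriv U x v)"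
      using assms(2) by (simp add: Ck1_iff eq cong: continuous_on_cong)
    moreover have "continuous_on (- K) (\<lambda>x. dir_deriv U x v)"
      by (rule continuous_on_eq[OF continuous_on_const[of _ 0]]) (simp add: dir_deriv_eq[OF off])
    ultimately have "continuous_on (\<Omega> \<union> - K) (\<lambda>x. dir_deriv U x v)"
      by (rule continuous_on_open_Un[OF assms(1) oK])
    moreover have "\<Omega> \<union> - K = UNIV" using K(2) by auto
    ultimately show "continuous_on UNIV (\<lambda>x. dir_deriv U x v)" by simp
  qed
qed

section \<open>Divergence-free fields\<close>

lemma dir_deriv_outside_support:
  assumes "compact K" and "\<And>x. x \<notin> K \<Longrightarrow> h x = 0" and "x \<notin> K"
  shows "dir_deriv h x v = 0"
proof -
  have "open (- K)" using assms(1) by (simp add: compact_imp_closed open_Compl)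
  then have "(h has_derivative (\<lambda>_. 0)) (at x)"
    using has_derivative_transform_within_open[of "\<lambda>_. 0" "\<lambda>_. 0" x UNIV "- K" h] assms by auto
  then show ?thesis by (rule dir_deriv_eq)
qed

lemma integrable_compact_support:
  fixes f :: "'a::euclidean_space \<Rightarrow> real"
  assumes "continuous_on UNIV f" and K: "compact K" "\<And>x. x \<notin> K \<Longrightarrow> f x = 0"
  shows "integrable lborel f"
proof -
  have "integrable lborel (\<lambda>x. indicator K x *\<^sub>R f x)"
    using assms by (intro borel_integrable_compact continuous_on_subset[OF assms(1)]) auto
  moreover have "(\<lambda>x. indicator K x *\<^sub>R f x) = f"
    using K(2) by (auto simp: indicator_def fun_eq_iff)
  ultimately show ?thesis by simp
qed

lemma integral_translation_lborel:
  fixes f :: "'a::euclidean_space \<Rightarrow> real"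
  assumes [measurable]: "f \<in> borel_measurable borel"
  shows "(\<integral>x. f (c + x) \<partial>lborel) = (\<integral>x. f x \<partial>lborel)"
proof -
  have "(\<integral>x. f x \<partial>lborel) = (\<integral>x. f x \<partial>distr lborel borel ((+) c))"
    by (simp add: lborel_distr_plus)
  also have "\<dots> = (\<integral>x. f (c + x) \<partial>lborel)"
    by (subst integral_distr) auto
  finally show ?thesis ..
qed

text \<open>The integral of a difference quotient vanishes by translation invariance of Lebesgue
  measure, and the difference quotients are dominated by a multiple of the indicator of a ball.\<close>

lemma integral_dir_deriv_eq_0:
  fixes h :: "'a::euclidean_space \<Rightarrow> real"
  assumes h: "Ck_on 1 h UNIV" and K: "compact K" "\<And>x. x \<notin> K \<Longrightarrow> h x = 0"
  shows "(\<integral>x. dir_deriv h x v \<partial>lborel) = 0"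
proof -
  have hc: "continuous_on UNIV h" by (rule Ck1_continuous[OF h])
  have dc: "continuous_on UNIV (\<lambda>x. dir_deriv h x v)" using h by (simp add: Ck1_iff)
  have [measurable]: "h \<in> borel_measurable borel" "(\<lambda>x. dir_deriv h x v) \<in> borel_measurable borel"
    using hc dc by (auto intro: borel_measurable_continuous_onI)
  obtain R where R: "K \<subseteq> cball 0 R" "R \<ge> 0"
    using bounded_subset_ballD[OF compact_imp_bounded[OF K(1)], of 0]
    by (metis ball_subset_cball less_imp_le subset_trans)
  obtain M where M: "\<And>x. \<bar>dir_deriv h x v\<bar> \<le> M" "M \<ge> 0"
  proof -
    have "compact ((\<lambda>x. dir_deriv h x v) ` K)"
      using dc K(1) continuous_on_subset by (intro compact_continuous_image) auto
    then obtain B where "B > 0" "\<And>x. x \<in> K \<Longrightarrow> \<bar>dir_deriv h x v\<bar> \<le> B"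
      using compact_imp_bounded bounded_pos[of "(\<lambda>x. dir_deriv h x v) ` K"] by auto
    moreover have "\<bar>dir_deriv h x v\<bar> \<le> B" if "x \<notin> K" for x
      using dir_deriv_outside_support[OF K that] \<open>B > 0\<close> by simp
    ultimately show ?thesis using that[of B] by fastforce
  qed
  define q where "q m x = real (Suc m) * (h (v /\<^sub>R real (Suc m) + x) - h x)" for m x
  have along: "((\<lambda>t. h (t *\<^sub>R v + x)) has_real_derivative dir_deriv h (t *\<^sub>R v + x) v) (at t)" for t x
  proof -
    have "((\<lambda>t. t *\<^sub>R v + x) has_derivative (\<lambda>s. s *\<^sub>R v)) (at t)"
      by (auto intro!: derivative_eq_intros)
    then have "((\<lambda>t. h (t *\<^sub>R v + x)) has_derivative (\<lambda>s. dir_deriv h (t *\<^sub>R v + x) (s *\<^sub>R v))) (at t)"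
      by (rule has_derivative_compose) (rule Ck1_has_derivative[OF h])
    moreover have "dir_deriv h (t *\<^sub>R v + x) (s *\<^sub>R v) = dir_deriv h (t *\<^sub>R v + x) v * s" for s
      using linear_cmul[OF dir_deriv_linear[OF h]] by simp
    ultimately show ?thesis by (simp add: has_field_derivative_def)
  qed
  have bound: "\<bar>q m x\<bar> \<le> M * indicator (cball 0 (R + norm v)) x" for m x
  proof (cases "x \<in> cball 0 (R + norm v)")
    case True
    define \<tau> where "\<tau> = 1 / real (Suc m)"
    have "\<tau> > 0" by (simp add: \<tau>_def)
    then obtain z where "h (\<tau> *\<^sub>R v + x) - h (0 *\<^sub>R v + x) = (\<tau> - 0) * dir_deriv h (z *\<^sub>R v + x) v"
      using MVT2[of 0 \<tau> "\<lambda>t. h (t *\<^sub>R v + x)" "\<lambda>t. dir_deriv h (t *\<^sub>R v + x) v"] along by blast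
    then have "q m x = dir_deriv h (z *\<^sub>R v + x) v"
      unfolding q_def \<tau>_def by (simp add: divide_inverse)
    then show ?thesis using M(1) True by simp
  next
    case False
    have "norm (v /\<^sub>R real (Suc m)) \<le> norm v"
      by (simp add: divide_simps mult_le_cancel_left1)
    moreover have "norm x \<le> norm (v /\<^sub>R real (Suc m) + x) + norm (v /\<^sub>R real (Suc m))"
      by (metis add_diff_cancel_left' norm_triangle_ineq4)
    moreover have "norm y \<le> R" if "y \<in> K" for y
      using R(1) that by (auto simp: subset_eq)
    moreover have "norm x > R + norm v" using False by simp
    ultimately have "v /\<^sub>R real (Suc m) + x \<notin> K" "x \<notin> K"
      using norm_ge_zero[of v] by fastforce+
    with False show ?thesis by (simp add: q_def K(2))
  qed
  have lim: "(\<lambda>m. q m x) \<longlonglongrightarrow> dir_deriv h x v" for x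
  proof -
    have "((\<lambda>t. (h ((0 + t) *\<^sub>R v + x) - h (0 *\<^sub>R v + x)) / t) \<longlongrightarrow> dir_deriv h (0 *\<^sub>R v + x) v) (at 0)"
      using along[of x 0] unfolding DERIV_def .
    moreover have "filterlim (\<lambda>m. 1 / real (Suc m)) (at 0) sequentially"
      using LIMSEQ_inverse_real_of_nat by (auto simp: filterlim_at inverse_eq_divide)
    ultimately have "(\<lambda>m. (h ((0 + 1 / real (Suc m)) *\<^sub>R v + x) - h (0 *\<^sub>R v + x)) / (1 / real (Suc m)))
        \<longlonglongrightarrow> dir_deriv h (0 *\<^sub>R v + x) v"
      by (rule filterlim_compose)
    then show ?thesis by (simp add: q_def divide_inverse mult.commute)
  qed
  have "(\<lambda>m. \<integral>x. q m x \<partial>lborel) \<longlonglongrightarrow> (\<integral>x. dir_deriv h x v \<partial>lborel)"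
  proof (rule integral_dominated_convergence)
    show "integrable lborel (\<lambda>x. M * indicator (cball 0 (R + norm v)) x)"
      by (intro integrable_mult_right integrable_real_indicator)
        (simp_all add: emeasure_lborel_cball_finite[unfolded infinity_ennreal_def])
  qed (use lim bound in \<open>auto simp: q_def\<close>)
  moreover have "(\<integral>x. q m x \<partial>lborel) = 0" for m
  proof -
    have "integrable lborel h" using hc K by (rule integrable_compact_support)
    moreover from this have "integrable lborel (\<lambda>x. h (v /\<^sub>R real (Suc m) + x))"
    proof -
      have "integrable (distr lborel borel ((+) (v /\<^sub>R real (Suc m)))) h"
        using \<open>integrable lborel h\<close> by (simp add: lborel_distr_plus)
      then show ?thesis by (subst (asm) integrable_distr_eq) auto
    qed
    ultimately show ?thesis
      unfolding q_def by (simp add: integral_translation_lborel)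
  qed
  ultimately show ?thesis
    by (simp add: LIMSEQ_const_iff)
qed

text \<open>
  For a divergence-free field, \<open>Y h\<close> equals the divergence of \<open>h Y\<close>, a sum of partial derivatives of
  compactly supported functions.
\<close>

lemma integral_along_divergence_free_eq_0:
  fixes h :: "'a::euclidean_space \<Rightarrow> real" and Y :: "'a \<Rightarrow> 'a"
  assumes h: "Ck_on 1 h UNIV" and K: "compact K" "\<And>x. x \<notin> K \<Longrightarrow> h x = 0"
    and Y: "Ck_on 1 Y UNIV" and div0: "\<And>x. (\<Sum>b\<in>Basis. dir_deriv Y x b \<bullet> b) = 0"
  shows "(\<integral>x. dir_deriv h x (Y x) \<partial>lborel) = 0"
proof -
  have Yb: "Ck_on 1 (\<lambda>x. Y x \<bullet> b) UNIV" "dir_deriv (\<lambda>x. Y x \<bullet> b) x v = dir_deriv Y x v \<bullet> b" for b x v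
    using Ck1_linear_comp[OF Y bounded_linear_inner_left] by auto
  have hY: "Ck_on 1 (\<lambda>x. h x * (Y x \<bullet> b)) UNIV" for b
    by (rule Ck1_mult[OF h Yb(1)])
  have int: "integrable lborel (\<lambda>x. dir_deriv (\<lambda>x. h x * (Y x \<bullet> b)) x b)" for b
    using hY[of b] K
    by (intro integrable_compact_support[OF _ K(1)] dir_deriv_outside_support[OF K(1)])
       (auto simp: Ck1_iff)
  have "dir_deriv h x (Y x) = (\<Sum>b\<in>Basis. dir_deriv (\<lambda>x. h x * (Y x \<bullet> b)) x b)" for x
  proof -
    interpret linear "dir_deriv h x" by (rule dir_deriv_linear[OF h])
    have "dir_deriv h x (Y x) = dir_deriv h x (\<Sum>b\<in>Basis. (Y x \<bullet> b) *\<^sub>R b)"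
      by (simp add: euclidean_representation)
    also have "\<dots> = h x * (\<Sum>b\<in>Basis. dir_deriv Y x b \<bullet> b) + (\<Sum>b\<in>Basis. dir_deriv h x b * (Y x \<bullet> b))"
      by (simp add: sum scale div0 mult.commute)
    also have "\<dots> = (\<Sum>b\<in>Basis. dir_deriv (\<lambda>x. h x * (Y x \<bullet> b)) x b)"
      by (simp add: Ck1_mult(2)[OF h Yb(1)] Yb(2) sum.distrib sum_distrib_left)
    finally show ?thesis .
  qed
  then have "(\<integral>x. dir_deriv h x (Y x) \<partial>lborel) =
      (\<Sum>b\<in>Basis. \<integral>x. dir_deriv (\<lambda>x. h x * (Y x \<bullet> b)) x b \<partial>lborel)"
    using int by simp
  also have "\<dots> = 0"
    using K by (intro sum.neutral ballI integral_dir_deriv_eq_0[OF hY K(1)]) auto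
  finally show ?thesis .
qed

section \<open>Hardy inequality along divergence-free fields\<close>

text \<open>
  Complete the square with \<open>F\<^sub>k = l\<^sub>k / (\<Sum>\<^sub>m l\<^sub>m\<^sup>2 + e)\<close> and integrate: the terms \<open>Y\<^sub>k (v\<^sup>2 F\<^sub>k)\<close> drop out
  because \<open>Y\<^sub>k\<close> is divergence free.  That \<open>Y\<^sub>k\<close> differentiates \<open>l\<^sub>m\<close> to \<open>2\<delta>\<^sub>k\<^sub>m\<close> models two particles that
  move apart at unit speed along axis \<open>k\<close>, with \<open>l\<^sub>m\<close> the difference of their \<open>m\<close>-th coordinates.
  The positive \<open>e\<close> keeps \<open>F\<^sub>k\<close> smooth across the common zero set of the \<open>l\<^sub>m\<close>; the constant is the
  same for all \<open>e\<close>.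
\<close>

lemma regularised_hardy:
  fixes v :: "'a::euclidean_space \<Rightarrow> real" and Y :: "'k \<Rightarrow> 'a \<Rightarrow> 'a" and l :: "'k \<Rightarrow> 'a \<Rightarrow> real"
  assumes S: "finite S" "card S \<ge> 2"
    and l: "\<And>k. k \<in> S \<Longrightarrow> bounded_linear (l k)"
    and Y: "\<And>k. k \<in> S \<Longrightarrow> Ck_on 1 (Y k) UNIV"
    and div0: "\<And>k x. k \<in> S \<Longrightarrow> (\<Sum>b\<in>Basis. dir_deriv (Y k) x b \<bullet> b) = 0"
    and lY: "\<And>k m x. k \<in> S \<Longrightarrow> m \<in> S \<Longrightarrow> l m (Y k x) = (if m = k then 2 else 0)"
    and v: "Ck_on 1 v UNIV" and K: "compact K" "\<And>x. x \<notin> K \<Longrightarrow> v x = 0"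
    and e: "e > 0"
  shows "(real (card S) - 2)\<^sup>2 * (\<integral>x. (v x)\<^sup>2 / ((\<Sum>m\<in>S. (l m x)\<^sup>2) + e) \<partial>lborel)
    \<le> (\<integral>x. (\<Sum>k\<in>S. (dir_deriv v x (Y k x))\<^sup>2) \<partial>lborel)"
proof -
  \<comment> \<open>The maximiser of \<open>2\<alpha>(N - 2) - \<alpha>\<^sup>2\<close> for \<open>N = card S\<close>.\<close>
  define \<alpha> where "\<alpha> = real (card S) - 2"
  have \<alpha>: "\<alpha> \<ge> 0" using S by (simp add: \<alpha>_def)
  define \<rho> where "\<rho> x = (\<Sum>m\<in>S. (l m x)\<^sup>2) + e" for x
  have pos: "\<rho> x > 0" for x unfolding \<rho>_def by (simp add: add_nonneg_pos e sum_nonneg)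
  have nz: "\<rho> x \<noteq> 0" for x using pos[of x] by simp
  have lc: "continuous_on UNIV (l k)" if "k \<in> S" for k
    using l[OF that] by (simp add: linear_continuous_on)
  have \<rho>c: "continuous_on UNIV \<rho>" unfolding \<rho>_def by (intro continuous_intros lc)
  define F where "F k x = l k x / \<rho> x" for k x
  define F' where "F' k x y = l k y / \<rho> x - l k x * (\<Sum>m\<in>S. 2 * l m x * l m y) / (\<rho> x)\<^sup>2" for k x y
  have F': "(F k has_derivative F' k x) (at x)" if "k \<in> S" for k x
  proof -
    have "(l m has_derivative l m) (at x)" if "m \<in> S" for m
      using l[OF that] by (rule bounded_linear_imp_has_derivative)
    then have "(\<rho> has_derivative (\<lambda>y. \<Sum>m\<in>S. 2 * l m x * l m y)) (at x)"
      unfolding \<rho>_def by (auto intro!: derivative_eq_intros sum.cong simp: algebra_simps)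
    moreover have "(l k has_derivative l k) (at x)"
      using l[OF that] by (rule bounded_linear_imp_has_derivative)
    ultimately show ?thesis
      unfolding F_def F'_def using nz[of x]
      by (auto intro!: derivative_eq_intros simp: field_simps power2_eq_square)
  qed
  have F: "Ck_on 1 (F k) UNIV" if "k \<in> S" for k
  proof (rule Ck1_I[OF F'[OF that]])
    show "continuous_on UNIV (\<lambda>x. F' k x y)" for y
      unfolding F'_def using nz by (intro continuous_intros lc \<rho>c that) auto
  qed
  have DF: "dir_deriv (F k) x y = F' k x y" if "k \<in> S" for k x y
    by (rule dir_deriv_eq[OF F'[OF that]])
  have vv: "Ck_on 1 (\<lambda>x. v x * v x) UNIV" by (rule Ck1_mult[OF v v])
  define h where "h k x = v x * v x * F k x" for k x
  have h: "Ck_on 1 (h k) UNIV" if "k \<in> S" for k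
    unfolding h_def by (rule Ck1_mult[OF vv F[OF that]])
  have hK: "h k x = 0" if "x \<notin> K" for k x using K(2)[OF that] by (simp add: h_def)
  have Dh: "dir_deriv (h k) x y = (v x)\<^sup>2 * F' k x y + 2 * v x * dir_deriv v x y * F k x"
    if "k \<in> S" for k x y
    unfolding h_def Ck1_mult(2)[OF vv F[OF that]] Ck1_mult(2)[OF v v] DF[OF that]
    by (simp add: power2_eq_square algebra_simps)
  have h0: "(\<integral>x. dir_deriv (h k) x (Y k x) \<partial>lborel) = 0" if "k \<in> S" for k
    using integral_along_divergence_free_eq_0[OF h[OF that] K(1) hK Y[OF that] div0[OF that]] by simp
  \<comment> \<open>The summands contribute \<open>2 N / \<rho>\<close> in total, and differentiating \<open>1 / \<rho>\<close> costs at most \<open>4 / \<rho>\<close>.\<close>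
  have divF: "(\<Sum>k\<in>S. F' k x (Y k x)) \<ge> 2 * \<alpha> / \<rho> x" for x
  proof -
    have "F' k x (Y k x) = 2 / \<rho> x - 4 * (l k x)\<^sup>2 / (\<rho> x)\<^sup>2" if "k \<in> S" for k
    proof -
      have "(\<Sum>m\<in>S. 2 * l m x * l m (Y k x)) = (\<Sum>m\<in>S. if m = k then 4 * l k x else 0)"
        using that by (intro sum.cong) (auto simp: lY)
      also have "\<dots> = 4 * l k x" using that S by simp
      finally show ?thesis using that by (simp add: F'_def lY power2_eq_square)
    qed
    then have "(\<Sum>k\<in>S. F' k x (Y k x)) = real (card S) * (2 / \<rho> x) - 4 * (\<rho> x - e) / (\<rho> x)\<^sup>2"
      by (simp add: sum_subtractf sum_divide_distrib[symmetric] sum_distrib_left[symmetric] \<rho>_def)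
    also have "\<dots> \<ge> real (card S) * (2 / \<rho> x) - 4 * \<rho> x / (\<rho> x)\<^sup>2"
      using e by (intro diff_left_mono divide_right_mono) auto
    also have "real (card S) * (2 / \<rho> x) - 4 * \<rho> x / (\<rho> x)\<^sup>2 = 2 * \<alpha> / \<rho> x"
      using nz[of x] by (simp add: \<alpha>_def field_simps power2_eq_square)
    finally show ?thesis .
  qed
  have normF: "(\<Sum>k\<in>S. (F k x)\<^sup>2) \<le> 1 / \<rho> x" for x
  proof -
    have "(\<Sum>k\<in>S. (F k x)\<^sup>2) = (\<rho> x - e) / (\<rho> x)\<^sup>2"
      by (simp add: F_def power_divide sum_divide_distrib[symmetric] \<rho>_def)
    also have "\<dots> \<le> \<rho> x / (\<rho> x)\<^sup>2" using e by (intro divide_right_mono) auto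
    also have "\<dots> = 1 / \<rho> x" using nz[of x] by (simp add: power2_eq_square)
    finally show ?thesis .
  qed
  have pointwise: "\<alpha>\<^sup>2 * ((v x)\<^sup>2 / \<rho> x) \<le>
      (\<Sum>k\<in>S. (dir_deriv v x (Y k x))\<^sup>2) + \<alpha> * (\<Sum>k\<in>S. dir_deriv (h k) x (Y k x))" for x
  proof -
    have "0 \<le> (\<Sum>k\<in>S. (dir_deriv v x (Y k x) + \<alpha> * F k x * v x)\<^sup>2)"
      by (intro sum_nonneg) auto
    also have "\<dots> = (\<Sum>k\<in>S. (dir_deriv v x (Y k x))\<^sup>2)
        + \<alpha> * (\<Sum>k\<in>S. 2 * v x * dir_deriv v x (Y k x) * F k x) + (\<alpha>\<^sup>2 * (v x)\<^sup>2) * (\<Sum>k\<in>S. (F k x)\<^sup>2)"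
      by (simp add: power2_eq_square algebra_simps sum.distrib sum_distrib_left)
    also have "(\<Sum>k\<in>S. 2 * v x * dir_deriv v x (Y k x) * F k x) =
        (\<Sum>k\<in>S. dir_deriv (h k) x (Y k x)) - (v x)\<^sup>2 * (\<Sum>k\<in>S. F' k x (Y k x))"
      by (simp add: Dh sum.distrib sum_distrib_left)
    finally have "\<alpha> * ((v x)\<^sup>2 * (\<Sum>k\<in>S. F' k x (Y k x))) - (\<alpha>\<^sup>2 * (v x)\<^sup>2) * (\<Sum>k\<in>S. (F k x)\<^sup>2)
       \<le> (\<Sum>k\<in>S. (dir_deriv v x (Y k x))\<^sup>2) + \<alpha> * (\<Sum>k\<in>S. dir_deriv (h k) x (Y k x))"
      by (simp add: algebra_simps)
    moreover have "\<alpha> * ((v x)\<^sup>2 * (2 * \<alpha> / \<rho> x)) \<le> \<alpha> * ((v x)\<^sup>2 * (\<Sum>k\<in>S. F' k x (Y k x)))"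
      using \<alpha> divF by (intro mult_left_mono) auto
    moreover have "(\<alpha>\<^sup>2 * (v x)\<^sup>2) * (\<Sum>k\<in>S. (F k x)\<^sup>2) \<le> (\<alpha>\<^sup>2 * (v x)\<^sup>2) * (1 / \<rho> x)"
      using normF by (intro mult_left_mono) auto
    moreover have "\<alpha> * ((v x)\<^sup>2 * (2 * \<alpha> / \<rho> x)) - (\<alpha>\<^sup>2 * (v x)\<^sup>2) * (1 / \<rho> x) = \<alpha>\<^sup>2 * ((v x)\<^sup>2 / \<rho> x)"
      by (simp add: power2_eq_square algebra_simps)
    ultimately show ?thesis by linarith
  qed
  have Yc: "continuous_on UNIV (Y k)" if "k \<in> S" for k using Ck1_continuous[OF Y[OF that]] .
  have i1: "integrable lborel (\<lambda>x. \<Sum>k\<in>S. (dir_deriv v x (Y k x))\<^sup>2)"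
    by (intro integrable_compact_support[OF _ K(1)] continuous_intros continuous_on_dir_deriv_along v Yc)
      (auto simp: dir_deriv_outside_support[OF K])
  have i2: "integrable lborel (\<lambda>x. dir_deriv (h k) x (Y k x))" if "k \<in> S" for k
    using that
    by (intro integrable_compact_support[OF _ K(1)] continuous_on_dir_deriv_along h Yc)
      (auto simp: dir_deriv_outside_support[OF K(1) hK])
  have i3: "integrable lborel (\<lambda>x. (v x)\<^sup>2 / \<rho> x)"
    using nz K by (intro integrable_compact_support[OF _ K(1)] continuous_intros \<rho>c Ck1_continuous[OF v]) auto
  have "\<alpha>\<^sup>2 * (\<integral>x. (v x)\<^sup>2 / \<rho> x \<partial>lborel) = (\<integral>x. \<alpha>\<^sup>2 * ((v x)\<^sup>2 / \<rho> x) \<partial>lborel)"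
    by (rule integral_mult_right_zero[symmetric])
  also have "\<dots> \<le> (\<integral>x. (\<Sum>k\<in>S. (dir_deriv v x (Y k x))\<^sup>2) + \<alpha> * (\<Sum>k\<in>S. dir_deriv (h k) x (Y k x)) \<partial>lborel)"
    by (intro integral_mono pointwise integrable_mult_right i3 Bochner_Integration.integrable_add[OF i1])
      (simp add: i2)
  also have "\<dots> = (\<integral>x. (\<Sum>k\<in>S. (dir_deriv v x (Y k x))\<^sup>2) \<partial>lborel)"
    using i1 i2 by (simp add: h0)
  finally show ?thesis by (simp add: \<alpha>_def \<rho>_def)
qed

text \<open>
  The weights \<open>1 / (d + e)\<close> increase to \<open>1 / d\<close> as \<open>e\<close> decreases to zero, also where \<open>d = 0\<close>: the
  limit there is \<open>\<infinity>\<close> if \<open>q > 0\<close>, and \<open>0\<close> if \<open>q = 0\<close>, which agrees with the division of extended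
  reals.
\<close>

lemma nn_integral_singular_weight_le:
  fixes q d :: "'a::euclidean_space \<Rightarrow> real"
  assumes qc: "continuous_on UNIV q" and dc: "continuous_on UNIV d"
    and q0: "\<And>x. q x \<ge> 0" and d0: "\<And>x. d x \<ge> 0"
    and K: "compact K" "\<And>x. x \<notin> K \<Longrightarrow> q x = 0" and C: "C \<ge> 0"
    and le: "\<And>e. e > 0 \<Longrightarrow> C * (\<integral>x. q x / (d x + e) \<partial>lborel) \<le> I"
  shows "ennreal C * (\<integral>\<^sup>+x. ennreal (q x) / ennreal (d x) \<partial>lborel) \<le> ennreal I"
proof -
  define e where "e m = 1 / real (Suc m)" for m
  have e: "e m > 0" for m by (simp add: e_def)
  have e0: "e \<longlonglongrightarrow> 0"
    using LIMSEQ_inverse_real_of_nat by (simp add: e_def[abs_def] inverse_eq_divide)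
  have pos: "d x + e m > 0" for x m using d0[of x] e[of m] by simp
  define f where "f m x = ennreal (q x / (d x + e m))" for m x
  have [measurable]: "q \<in> borel_measurable borel" "d \<in> borel_measurable borel"
    using qc dc by (auto intro: borel_measurable_continuous_onI)
  have [measurable]: "f m \<in> borel_measurable lborel" for m
    unfolding f_def[abs_def] by measurable
  have inc: "incseq f"
  proof (intro incseq_SucI le_funI)
    fix m x
    have "e (Suc m) \<le> e m" by (simp add: e_def field_simps)
    then show "f m x \<le> f (Suc m) x"
      unfolding f_def using pos[of x "Suc m"] q0[of x] by (intro ennreal_leI divide_left_mono) auto
  qed
  have sup: "ennreal (q x) / ennreal (d x) = (SUP m. f m x)" for x
  proof -
    have "(\<lambda>m. ennreal (d x + e m)) \<longlonglongrightarrow> ennreal (d x + 0)"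
      by (intro tendsto_ennrealI tendsto_add tendsto_const e0)
    then have "(\<lambda>m. inverse (ennreal (d x + e m))) \<longlonglongrightarrow> inverse (ennreal (d x + 0))"
      by (rule continuous_on_tendsto_compose[OF continuous_on_inverse_ennreal[OF continuous_on_id[of UNIV]]]) auto
    then have "(\<lambda>m. ennreal (q x) * inverse (ennreal (d x + e m))) \<longlonglongrightarrow>
        ennreal (q x) * inverse (ennreal (d x + 0))"
      by (rule ennreal_tendsto_cmult[rotated]) simp
    moreover have "ennreal (q x) * inverse (ennreal (d x + e m)) = f m x" for m
      using divide_ennreal[OF q0 pos] by (simp add: f_def divide_ennreal_def)
    ultimately have "(\<lambda>m. f m x) \<longlonglongrightarrow> ennreal (q x) / ennreal (d x)"
      by (simp add: divide_ennreal_def)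
    moreover have "(\<lambda>m. f m x) \<longlonglongrightarrow> (SUP m. f m x)"
      using inc by (intro LIMSEQ_SUP) (auto simp: incseq_def le_fun_def)
    ultimately show ?thesis by (rule LIMSEQ_unique)
  qed
  have "ennreal C * (\<integral>\<^sup>+x. ennreal (q x) / ennreal (d x) \<partial>lborel) =
      (SUP m. ennreal C * (\<integral>\<^sup>+x. f m x \<partial>lborel))"
    unfolding sup using inc
    by (subst nn_integral_monotone_convergence_SUP) (auto simp: SUP_mult_left_ennreal)
  also have "\<dots> \<le> ennreal I"
  proof (rule SUP_least)
    fix m
    have nz: "d x + e m \<noteq> 0" for x using pos[of x m] by simp
    have "integrable lborel (\<lambda>x. q x / (d x + e m))"
      using nz K(2) by (intro integrable_compact_support[OF _ K(1)] continuous_intros qc dc) auto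
    then have "(\<integral>\<^sup>+x. f m x \<partial>lborel) = ennreal (\<integral>x. q x / (d x + e m) \<partial>lborel)"
      unfolding f_def using q0 pos by (intro nn_integral_eq_integral) (auto intro!: divide_nonneg_pos)
    then show "ennreal C * (\<integral>\<^sup>+x. f m x \<partial>lborel) \<le> ennreal I"
      using le[OF e, of m] C by (simp add: ennreal_mult'[symmetric] ennreal_leI)
  qed
  finally show ?thesis .
qed

section \<open>Homogeneity in a stratified group\<close>

lemma dilation_nth [simp]: "dilation w s y $ m = s ^ w m * y $ m"
  by (simp add: dilation_def)

lemma bounded_linear_dilation: "bounded_linear (dilation w s)"
  unfolding linear_conv_bounded_linear[symmetric]
  by (rule linearI) (auto simp: vec_eq_iff algebra_simps)

text \<open>
  Only coordinates of weight one survive to first order.  The dilation formula makes sense for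
  \<open>s \<le> 0\<close> too, with \<open>\<delta>\<^sub>0 y = 0\<close>, so that \<open>s \<mapsto> \<delta>\<^sub>s y\<close> is a curve through the origin.
\<close>

lemma dilation_has_vector_derivative_0:
  assumes "\<And>m. w m \<ge> 1"
  shows "((\<lambda>s. dilation w s y) has_vector_derivative
    (\<chi> m. if w m = 1 then y $ m else 0)) (at 0 within S)"
proof -
  have eq: "dilation w s y = (\<Sum>m\<in>UNIV. s ^ w m *\<^sub>R axis m (y $ m))" for s
    by (auto simp: vec_eq_iff axis_def if_distrib[where f="\<lambda>x. _ * x"] cong: if_cong)
  have "((\<lambda>s. s ^ w m *\<^sub>R axis m (y $ m)) has_vector_derivative
      (if w m = 1 then axis m (y $ m) else 0)) (at 0 within S)" for m
  proof -
    have "((\<lambda>s. s ^ w m) has_real_derivative (if w m = 1 then 1 else 0)) (at 0 within S)"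
      using assms[of m] by (auto intro!: derivative_eq_intros simp: zero_power)
    then show ?thesis
      using has_vector_derivative_scaleR[OF _ has_vector_derivative_const] by fastforce
  qed
  then have "((\<lambda>s. dilation w s y) has_vector_derivative
      (\<Sum>m\<in>UNIV. if w m = 1 then axis m (y $ m) else 0)) (at 0 within S)"
    unfolding eq by (intro has_vector_derivative_sum) auto
  also have "(\<Sum>m\<in>UNIV. if w m = 1 then axis m (y $ m) else 0) = (\<chi> m. if w m = 1 then y $ m else 0)"
  proof -
    have "(\<Sum>m\<in>UNIV. (if w m = 1 then axis m (y $ m) else 0) $ i) =
        (\<Sum>m\<in>UNIV. if m = i then (if w m = 1 then y $ m else 0) else 0)" for i
      by (intro sum.cong) (auto simp: axis_def)
    then show ?thesis by (auto simp: vec_eq_iff)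
  qed
  finally show ?thesis .
qed

context stratified_group
begin

interpretation G: group gmult 0 ginv by (rule group_axioms)

lemma weight_pos: "w m \<ge> 1"
  using weights by (metis atLeastAtMost_iff rangeI)

lemma dilation_zero_factor: "dilation w 0 y = 0"
  using weight_pos by (auto simp: vec_eq_iff zero_power Suc_le_eq)

lemma Ck1_gmult: "Ck_on 1 (\<lambda>p. gmult (fst p) (snd p)) UNIV"
  using smooth_gmult unfolding smooth_on_def by blast

text \<open>
  A first stratum coordinate \<open>g\<close> of the group law is homogeneous of degree one, so its derivative
  at the origin along the curve \<open>s \<mapsto> (\<delta>\<^sub>s x, \<delta>\<^sub>s y)\<close> is \<open>g (x, y)\<close> itself.  The chain rule
  expresses the same derivative linearly in the first stratum parts of \<open>x\<close> and \<open>y\<close>; setting one of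
  the arguments to zero identifies the linear map.
\<close>

lemma gmult_first_stratum:
  assumes "w k = 1"
  shows "gmult x y $ k = x $ k + y $ k"
proof -
  define g where "g p = gmult (fst p) (snd p) $ k" for p
  obtain D where D: "(g has_derivative D) (at (0, 0))"
    using Ck1_linear_comp(1)[OF Ck1_gmult bounded_linear_vec_nth, of k] Ck1_has_derivative
    unfolding g_def by blast
  interpret D: linear D using D has_derivative_linear by blast
  define P where "P y = (\<chi> m. if w m = 1 then y $ m else 0)" for y :: "real ^ 'd"
  have gD: "g (x, y) = D (P x, P y)" for x y
  proof -
    define c where "c s = (dilation w s x, dilation w s y)" for s
    have "(c has_vector_derivative (P x, P y)) (at 0 within {0..})"
      unfolding c_def P_def
      by (intro has_vector_derivative_Pair dilation_has_vector_derivative_0 weight_pos)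
    moreover have "(g has_derivative D) (at (c 0) within c ` {0..})"
      using D by (simp add: c_def dilation_zero_factor has_derivative_at_withinI)
    ultimately have "((\<lambda>s. g (c s)) has_vector_derivative D (P x, P y)) (at 0 within {0..})"
      using vector_derivative_diff_chain_within[of c "(P x, P y)" 0 "{0..}" g D] by (simp add: comp_def)
    moreover have "((\<lambda>s. g (c s)) has_vector_derivative g (x, y)) (at 0 within {0..})"
    proof -
      have hv: "((\<lambda>s. s *\<^sub>R g (x, y)) has_vector_derivative g (x, y)) (at 0 within {0..})"
        by (auto intro!: derivative_eq_intros)
      have gc: "g (c s) = s *\<^sub>R g (x, y)" if "s \<in> {0..}" for s
      proof (cases "s = 0")
        case True
        then show ?thesis by (simp add: g_def c_def dilation_zero_factor G.group_left_neutral)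
      next
        case False
        then have "gmult (dilation w s x) (dilation w s y) = dilation w s (gmult x y)"
          using that dilation_hom[of s x y] by simp
        then show ?thesis using assms by (simp add: g_def c_def)
      qed
      show ?thesis
        by (rule has_vector_derivative_transform[OF _ gc hv]) simp_all
    qed
    moreover have "at (0::real) within {0..} \<noteq> bot"
      by (simp add: at_within_Ici_at_right)
    ultimately show ?thesis
      using vector_derivative_unique_within by blast
  qed
  have "g (x, y) = D (P x, 0) + D (0, P y)"
    using gD[of x y] D.add[of "(P x, 0)" "(0, P y)"] by simp
  also have "\<dots> = g (x, 0) + g (0, y)"
  proof -
    have "P 0 = 0" by (simp add: P_def vec_eq_iff)
    then show ?thesis by (simp add: gD)
  qed
  finally show ?thesis
    by (simp add: g_def G.group_left_neutral)
qed

lemma ginv_first_stratum: "w k = 1 \<Longrightarrow> ginv x $ k = - x $ k"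
  using gmult_first_stratum[of k x "ginv x"] G.right_inverse[of x]
  by (simp add: eq_neg_iff_add_eq_0 add.commute)

lemma particle_dist_eq:
  "(particle_dist w gmult ginv x i j)\<^sup>2 = (\<Sum>k\<in>first_stratum w. (x $ i $ k - x $ j $ k)\<^sup>2)"
  unfolding particle_dist_def L2_set_def
  by (simp add: sum_nonneg first_stratum_def gmult_first_stratum ginv_first_stratum)

abbreviation (input) X :: "'d \<Rightarrow> real ^ 'd \<Rightarrow> real ^ 'd" where
  "X \<equiv> jacobian_generator gmult"

text \<open>
  The group law is smooth as a function of both arguments; this expresses derivatives of left
  translations by its joint derivative, so that they inherit regularity in the base point.
\<close>

lemma left_translation_has_derivative:
  "(gmult x has_derivative (\<lambda>v. dir_deriv (\<lambda>p. gmult (fst p) (snd p)) (x, y) (0, v))) (at y)"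
proof -
  have "((\<lambda>y. (x, y)) has_derivative (\<lambda>v. (0, v))) (at y)"
    by (auto intro!: derivative_eq_intros)
  from has_derivative_compose[OF this Ck1_has_derivative[OF Ck1_gmult]] show ?thesis by simp
qed

lemma jacobian_generator_eq:
  "X k x = dir_deriv (\<lambda>p. gmult (fst p) (snd p)) (x, 0) (0, axis k 1)"
  unfolding jacobian_generator_def by (rule dir_deriv_eq[OF left_translation_has_derivative])

lemma left_translation_derivative:
  "(gmult x has_derivative dir_deriv (gmult x) 0) (at 0)"
proof -
  have "gmult x differentiable (at 0)"
    using left_translation_has_derivative[of x 0] unfolding differentiable_def by blast
  then show ?thesis by (simp add: frechet_derivative_works[symmetric])
qed

lemma Ck1_jacobian_generator: "Ck_on 1 (X k) UNIV"
proof -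
  define Z where "Z p = dir_deriv (\<lambda>p. gmult (fst p) (snd p)) p (0, axis k 1)" for p
  have "Ck_on (Suc 1) (\<lambda>p. gmult (fst p) (snd p)) UNIV"
    using smooth_gmult unfolding smooth_on_def by blast
  then have Z: "Ck_on 1 Z UNIV"
    unfolding Z_def Ck_on.simps(2) by blast
  have eq: "X k = (\<lambda>x. Z (x, 0))" by (simp add: Z_def jacobian_generator_eq fun_eq_iff)
  show ?thesis unfolding eq
  proof (rule Ck1_I)
    have "((\<lambda>x. (x, 0::real^'d)) has_derivative (\<lambda>v. (v, 0))) (at x)" for x :: "real ^ 'd"
      by (auto intro!: derivative_eq_intros)
    then show "((\<lambda>x. Z (x, 0)) has_derivative (\<lambda>v. dir_deriv Z (x, 0) (v, 0))) (at x)" for x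
      using has_derivative_compose Ck1_has_derivative[OF Z] by blast
    have "continuous_on UNIV (\<lambda>p. dir_deriv Z p (v, 0))" for v
      using Z by (simp add: Ck1_iff)
    then show "continuous_on UNIV (\<lambda>x. dir_deriv Z (x, 0) (v, 0))" for v
      by (rule continuous_on_compose2) (auto intro!: continuous_intros)
  qed
qed

lemma jacobian_generator_first_stratum:
  assumes "w m = 1"
  shows "X k x $ m = (if m = k then 1 else 0)"
proof -
  have d1: "((\<lambda>y. gmult x y $ m) has_derivative (\<lambda>v. dir_deriv (gmult x) 0 v $ m)) (at 0)"
    by (rule bounded_linear.has_derivative[OF bounded_linear_vec_nth left_translation_derivative])
  have d2: "((\<lambda>y. gmult x y $ m) has_derivative (\<lambda>v. v $ m)) (at 0)"
    unfolding gmult_first_stratum[OF assms] 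
    by (auto intro!: derivative_eq_intros bounded_linear_imp_has_derivative bounded_linear_vec_nth)
  have "dir_deriv (gmult x) 0 (axis k 1) $ m = axis k 1 $ m"
    using fun_cong[OF has_derivative_unique[OF d1 d2], of "axis k 1"] .
  then show ?thesis by (simp add: jacobian_generator_def axis_def)
qed

text \<open>Differentiate \<open>\<delta>\<^sub>s (x \<circ> y) = \<delta>\<^sub>s x \<circ> \<delta>\<^sub>s y\<close> in \<open>y\<close> at the origin in direction \<open>k\<close>.\<close>

lemma jacobian_generator_homogeneous:
  assumes "w k = 1" and s: "s > 0"
  shows "s *\<^sub>R X k (dilation w s x) = dilation w s (X k x)"
proof -
  have d1: "((\<lambda>y. dilation w s (gmult x y)) has_derivative (\<lambda>v. dilation w s (dir_deriv (gmult x) 0 v))) (at 0)"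
    by (rule bounded_linear.has_derivative[OF bounded_linear_dilation left_translation_derivative])
  have d2: "((\<lambda>y. gmult (dilation w s x) (dilation w s y)) has_derivative
      (\<lambda>v. dir_deriv (gmult (dilation w s x)) 0 (dilation w s v))) (at 0)"
  proof -
    have "(dilation w s has_derivative dilation w s) (at 0)"
      by (rule bounded_linear_imp_has_derivative[OF bounded_linear_dilation])
    moreover have "dilation w s 0 = 0" by (simp add: vec_eq_iff)
    then have "(gmult (dilation w s x) has_derivative dir_deriv (gmult (dilation w s x)) 0) (at (dilation w s 0))"
      using left_translation_derivative by simp
    ultimately show ?thesis by (rule has_derivative_compose)
  qed
  have "dir_deriv (gmult (dilation w s x)) 0 (dilation w s (axis k 1)) =
      dilation w s (dir_deriv (gmult x) 0 (axis k 1))"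
    using fun_cong[OF has_derivative_unique[OF d1[unfolded dilation_hom[OF s]] d2], of "axis k 1"] by simp
  moreover have "dilation w s (axis k 1) = s *\<^sub>R axis k 1"
    using assms by (auto simp: vec_eq_iff axis_def)
  ultimately show ?thesis
    using has_derivative_linear[OF left_translation_derivative]
    by (simp add: jacobian_generator_def linear_cmul)
qed

text \<open>
  The coefficient \<open>X\<^sub>k\<^sup>m\<close> has degree \<open>w m - 1\<close>, and \<open>\<partial>\<^sub>m\<close> lowers the degree by \<open>w m\<close>.  A continuous
  function of degree \<open>-1\<close> vanishes, as its values along \<open>s \<mapsto> \<delta>\<^sub>s x\<close> stay bounded when \<open>s\<close> tends
  to zero.
\<close>

lemma jacobian_generator_diagonal_derivative:
  assumes "w k = 1"
  shows "dir_deriv (X k) x (axis m 1) $ m = 0"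
proof -
  define \<phi> where "\<phi> x = dir_deriv (X k) x (axis m 1) $ m" for x
  have scale: "\<phi> x = s * \<phi> (dilation w s x)" if s: "s > 0" for s
  proof -
    have d1: "((\<lambda>x. dilation w s (X k x)) has_derivative (\<lambda>v. dilation w s (dir_deriv (X k) x v))) (at x)"
      by (rule bounded_linear.has_derivative[OF bounded_linear_dilation Ck1_has_derivative[OF Ck1_jacobian_generator]])
    have d2: "((\<lambda>x. s *\<^sub>R X k (dilation w s x)) has_derivative
        (\<lambda>v. s *\<^sub>R dir_deriv (X k) (dilation w s x) (dilation w s v))) (at x)"
      by (intro has_derivative_scaleR_right has_derivative_compose[OF
            bounded_linear_imp_has_derivative[OF bounded_linear_dilation]
            Ck1_has_derivative[OF Ck1_jacobian_generator]])
    have "dilation w s (dir_deriv (X k) x (axis m 1)) =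
        s *\<^sub>R dir_deriv (X k) (dilation w s x) (dilation w s (axis m 1))"
      using fun_cong[OF has_derivative_unique[OF d1 d2[unfolded jacobian_generator_homogeneous[OF assms s]]],
          of "axis m 1"] .
    moreover have "dilation w s (axis m 1) = s ^ w m *\<^sub>R axis m 1"
      by (auto simp: vec_eq_iff axis_def)
    ultimately have "dilation w s (dir_deriv (X k) x (axis m 1)) $ m =
        (s * s ^ w m) * \<phi> (dilation w s x)"
      using dir_deriv_linear[OF Ck1_jacobian_generator]
      by (simp add: linear_cmul \<phi>_def)
    then show ?thesis using s by (simp add: \<phi>_def)
  qed
  have "continuous_on UNIV \<phi>"
    using Ck1_jacobian_generator[of k] unfolding \<phi>_def Ck1_iff by (intro continuous_intros) auto
  moreover have "((\<lambda>s. dilation w s x) \<longlongrightarrow> 0) (at_right 0)"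
    using has_vector_derivative_continuous[OF dilation_has_vector_derivative_0[of w, OF weight_pos, where y=x and S="{0<..}"]]
    unfolding continuous_within dilation_zero_factor .
  ultimately have "((\<lambda>s. \<phi> (dilation w s x)) \<longlongrightarrow> \<phi> 0) (at_right 0)"
    by (intro continuous_on_tendsto_compose[of UNIV \<phi>]) auto
  then have "((\<lambda>s. s * \<phi> (dilation w s x)) \<longlongrightarrow> 0 * \<phi> 0) (at_right 0)"
    by (intro tendsto_mult tendsto_ident_at)
  moreover have "\<forall>\<^sub>F s in at_right 0. s * \<phi> (dilation w s x) = \<phi> x"
    using eventually_at_right_less[of "0::real"] by eventually_elim (rule scale[symmetric])
  ultimately have "((\<lambda>_::real. \<phi> x) \<longlongrightarrow> 0 * \<phi> 0) (at_right 0)"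
    by (rule Lim_transform_eventually)
  then have "\<phi> x = 0 * \<phi> 0"
    by (simp only: tendsto_const_iff trivial_limit_at_right_real not_False_eq_True)
  then show ?thesis
    by (simp add: \<phi>_def)
qed

end

section \<open>Particles in a stratified group\<close>

text \<open>
  The difference of the two sides is \<open>(\<Sum>\<^sub>i c\<^sub>i)\<^sup>2\<close>, the energy of the centre of mass.
\<close>

lemma sum_pairs_diff_sq_le:
  fixes c :: "'n::{finite,linorder} \<Rightarrow> real"
  shows "(\<Sum>(i, j) | i < j. (c i - c j)\<^sup>2) \<le> real CARD('n) * (\<Sum>i\<in>UNIV. (c i)\<^sup>2)"
proof -
  let ?g = "\<lambda>(i, j). (c i - c j)\<^sup>2"
  have swap: "sum ?g {(i, j). j < i} = sum ?g {(i, j). i < j}"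
    by (rule sum.reindex_bij_witness[of _ prod.swap prod.swap]) (auto simp: power2_commute)
  have "sum ?g UNIV = sum ?g ({(i, j). i < j} \<union> {(i, j). j < i})"
  proof (rule sum.mono_neutral_right)
    have "i = j" if "\<not> i < j" "\<not> j < i" for i j :: 'n
      using that by (simp add: antisym_conv3)
    then show "\<forall>p\<in>UNIV - ({(i, j). i < j} \<union> {(i, j). j < i}). ?g p = 0"
      by fastforce
  qed auto
  also have "\<dots> = 2 * sum ?g {(i, j). i < j}"
    using swap by (subst sum.union_disjoint) auto
  finally have "2 * sum ?g {(i, j). i < j} = sum ?g UNIV" ..
  also have "\<dots> = (\<Sum>i\<in>UNIV. \<Sum>j\<in>UNIV. (c i)\<^sup>2 + (c j)\<^sup>2 - 2 * (c i * c j))"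
    by (simp add: sum.cartesian_product power2_diff mult.assoc)
  also have "\<dots> = 2 * (real CARD('n) * (\<Sum>i\<in>UNIV. (c i)\<^sup>2)) - 2 * (\<Sum>i\<in>UNIV. c i)\<^sup>2"
    by (simp add: sum_subtractf sum.distrib sum_distrib_left[symmetric] sum_distrib_right[symmetric]
        power2_eq_square)
  also have "\<dots> \<le> 2 * (real CARD('n) * (\<Sum>i\<in>UNIV. (c i)\<^sup>2))" by simp
  finally show ?thesis by simp
qed

context stratified_group
begin

lemma divergence_particle_field:
  assumes "w k = 1"
  shows "(\<Sum>b\<in>Basis. dir_deriv (\<lambda>x::(real^'d)^'n::finite. axis i (X k (x $ i))) x b \<bullet> b) = 0"
proof (rule sum.neutral, rule ballI)
  fix b :: "(real ^ 'd) ^ 'n" assume "b \<in> Basis"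
  then obtain a m where b: "b = axis a (axis m 1)"
    by (auto simp: Basis_vec_def)
  have "dir_deriv (X k) (x $ i) (axis m 1) \<bullet> axis m 1 = 0"
    using jacobian_generator_diagonal_derivative[OF assms] by (simp add: cart_eq_inner_axis)
  then show "dir_deriv (\<lambda>x. axis i (X k (x $ i))) x b \<bullet> b = 0"
    unfolding Ck1_axis_field(2)[OF Ck1_jacobian_generator] b
    by (cases "a = i") (simp_all add: inner_axis_axis)
qed

definition relative_field :: "'n::finite \<Rightarrow> 'n \<Rightarrow> 'd \<Rightarrow> (real ^ 'd) ^ 'n \<Rightarrow> (real ^ 'd) ^ 'n" where
  "relative_field i j k x = axis i (X k (x $ i)) - axis j (X k (x $ j))"

lemma Ck1_relative_field: "Ck_on 1 (relative_field i j k) UNIV"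
  unfolding relative_field_def[abs_def]
  by (intro Ck1_diff Ck1_axis_field Ck1_jacobian_generator)

lemma divergence_relative_field:
  assumes "w k = 1"
  shows "(\<Sum>b\<in>Basis. dir_deriv (relative_field i j k) x b \<bullet> b) = 0"
  unfolding relative_field_def[abs_def]
    Ck1_diff(2)[OF Ck1_axis_field(1) Ck1_axis_field(1), OF Ck1_jacobian_generator Ck1_jacobian_generator]
  by (simp add: inner_diff_left sum_subtractf divergence_particle_field[OF assms])

text \<open>
  On first stratum coordinates \<open>X\<^sub>k\<close> acts as \<open>\<partial>\<^sub>k\<close>, so \<open>X\<^sub>i\<^sub>k - X\<^sub>j\<^sub>k\<close> maps \<open>x\<^sub>i\<^sub>m - x\<^sub>j\<^sub>m\<close> to \<open>2\<delta>\<^sub>k\<^sub>m\<close>, one unit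
  from each particle.
\<close>

lemma pair_hardy:
  fixes v :: "(real ^ 'd) ^ 'n::finite \<Rightarrow> real"
  assumes "i \<noteq> j" and N: "card (first_stratum w) \<ge> 2"
    and v: "Ck_on 1 v UNIV" and K: "compact K" "\<And>x. x \<notin> K \<Longrightarrow> v x = 0" and e: "e > 0"
  shows "(real (card (first_stratum w)) - 2)\<^sup>2 *
      (\<integral>x. (v x)\<^sup>2 / ((particle_dist w gmult ginv x i j)\<^sup>2 + e) \<partial>lborel)
    \<le> (\<integral>x. (\<Sum>k\<in>first_stratum w. (dir_deriv v x (relative_field i j k x))\<^sup>2) \<partial>lborel)"
  unfolding particle_dist_eq
proof (rule regularised_hardy[OF _ N])
  show "bounded_linear (\<lambda>x::(real^'d)^'n. x $ i $ k - x $ j $ k)" for k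
    by (intro bounded_linear_sub bounded_linear_compose[OF bounded_linear_vec_nth bounded_linear_vec_nth])
  show "relative_field i j k x $ i $ m - relative_field i j k x $ j $ m = (if m = k then 2 else 0)"
    if "k \<in> first_stratum w" "m \<in> first_stratum w" for k m x
    using that assms(1)
    by (auto simp: relative_field_def axis_def first_stratum_def jacobian_generator_first_stratum)
  show "(\<Sum>b\<in>Basis. dir_deriv (relative_field i j k) x b \<bullet> b) = 0" if "k \<in> first_stratum w" for k x
    using that by (simp add: divergence_relative_field first_stratum_def)
  show "Ck_on 1 (relative_field i j k) UNIV" for k
    by (rule Ck1_relative_field)
qed (use v K e in auto)

end

theorem theorem5p2:
  fixes w :: "'d::finite \<Rightarrow> nat"
    and r :: nat
    and gmult :: "real ^ 'd \<Rightarrow> real ^ 'd \<Rightarrow> real ^ 'd"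
    and ginv :: "real ^ 'd \<Rightarrow> real ^ 'd"
    and N n :: nat
    and \<Omega> :: "((real ^ 'd) ^ 'n::{finite,linorder}) set"
    and u :: "(real ^ 'd) ^ 'n::{finite,linorder} \<Rightarrow> complex"
  assumes "stratified_group w r gmult ginv"
    and "N = card (first_stratum w)" and "N \<ge> 2"
    and "n = CARD('n)" and "n \<ge> 3"
    and "open \<Omega>"
    and "Ck_on 1 u \<Omega>"
    and "compact_support_in u \<Omega>"
  shows "(\<integral>\<^sup>+x\<in>\<Omega>. ennreal ((horizontal_grad_norm w gmult u x)\<^sup>2) \<partial>lborel) \<ge>
         ennreal ((real N - 2)\<^sup>2 / real n) *
         (\<integral>\<^sup>+x\<in>\<Omega>. (\<Sum>(i, j) | i < j. ennreal ((cmod (u x))\<^sup>2) /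
                     ennreal ((particle_dist w gmult ginv x i j)\<^sup>2)) \<partial>lborel)"
proof -
  interpret stratified_group w r gmult ginv by fact
  let ?S = "first_stratum w"
  obtain K where K: "compact K" "K \<subseteq> \<Omega>" "\<And>x. x \<in> \<Omega> - K \<Longrightarrow> u x = 0"
    using assms(8) unfolding compact_support_in_def by blast
  define U where "U x = (if x \<in> \<Omega> then u x else 0)" for x
  have U: "Ck_on 1 U UNIV" and DU: "\<And>x v. x \<in> \<Omega> \<Longrightarrow> dir_deriv U x v = dir_deriv u x v"
    using Ck1_extend_by_zero[OF assms(6,7) K] unfolding U_def[abs_def] by blast+
  have UK: "U x = 0" if "x \<notin> K" for x using that K(3) by (auto simp: U_def)
  define a b where "a x = Re (U x)" and "b x = Im (U x)" for x
  have a: "Ck_on 1 a UNIV" "\<And>x v. dir_deriv a x v = Re (dir_deriv U x v)"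
    using Ck1_linear_comp[OF U bounded_linear_Re] by (simp_all only: a_def[abs_def])
  have b: "Ck_on 1 b UNIV" "\<And>x v. dir_deriv b x v = Im (dir_deriv U x v)"
    using Ck1_linear_comp[OF U bounded_linear_Im] by (simp_all only: b_def[abs_def])
  have aK: "a x = 0" and bK: "b x = 0" if "x \<notin> K" for x
    using UK[OF that] by (simp_all add: a_def b_def)
  define q where "q x = (a x)\<^sup>2 + (b x)\<^sup>2" for x
  have qc: "continuous_on UNIV q" unfolding q_def by (intro continuous_intros Ck1_continuous a b)
  have q: "(cmod (U x))\<^sup>2 = q x" for x by (simp add: q_def a_def b_def cmod_power2)
  \<comment> \<open>Pair Hardy holds for real functions; real and imaginary parts add up to the squared modulus.\<close>
  define E where "E x v = (dir_deriv a x v)\<^sup>2 + (dir_deriv b x v)\<^sup>2" for x v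
  have E: "E x v = (cmod (dir_deriv U x v))\<^sup>2" for x v by (simp add: E_def a b cmod_power2)
  have Ec: "continuous_on UNIV (\<lambda>x. E x (Y x))" if "continuous_on UNIV Y" for Y
    unfolding E_def by (intro continuous_intros continuous_on_dir_deriv_along a b that)
  have EK: "E x v = 0" if "x \<notin> K" for x v
    using dir_deriv_outside_support[OF K(1) aK that] dir_deriv_outside_support[OF K(1) bK that]
    by (simp add: E_def)
  define G where "G x = (\<Sum>i\<in>UNIV. \<Sum>k\<in>?S. E x (axis i (X k (x $ i))))" for x
  define P where "P i j x = (\<Sum>k\<in>?S. E x (relative_field i j k x))" for i j x
  have Xc: "continuous_on UNIV (\<lambda>x. axis i (X k (x $ i)))" for i :: 'n and k
    by (intro Ck1_continuous Ck1_axis_field Ck1_jacobian_generator)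
  have Gc: "continuous_on UNIV G" unfolding G_def by (intro continuous_intros Ec Xc)
  have Pc: "continuous_on UNIV (P i j)" for i j
    unfolding P_def by (intro continuous_intros Ec Ck1_continuous Ck1_relative_field)
  have P0: "P i j x \<ge> 0" for i j x unfolding P_def E_def by (intro sum_nonneg) auto
  have G0: "G x \<ge> 0" for x unfolding G_def E_def by (intro sum_nonneg) auto
  have [measurable]: "G \<in> borel_measurable borel" "P i j \<in> borel_measurable borel"
    "q \<in> borel_measurable borel" for i j
    using Gc Pc qc by (auto intro: borel_measurable_continuous_onI)

  have L: "(\<integral>\<^sup>+x\<in>\<Omega>. ennreal ((horizontal_grad_norm w gmult u x)\<^sup>2) \<partial>lborel) = (\<integral>\<^sup>+x. ennreal (G x) \<partial>lborel)"
  proof (rule nn_integral_cong)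
    fix x
    show "ennreal ((horizontal_grad_norm w gmult u x)\<^sup>2) * indicator \<Omega> x = ennreal (G x)"
    proof (cases "x \<in> \<Omega>")
      case True
      then have "(horizontal_grad_norm w gmult u x)\<^sup>2 = G x"
        by (simp add: horizontal_grad_norm_def particle_field_def G_def E DU sum_nonneg)
      with True show ?thesis by simp
    next
      case False
      then have "x \<notin> K" using K(2) by auto
      with False show ?thesis by (simp add: G_def EK)
    qed
  qed

  define d where "d i j x = (particle_dist w gmult ginv x i j)\<^sup>2" for i j :: 'n and x
  have dc: "continuous_on UNIV (d i j)" for i j
    unfolding d_def particle_dist_eq by (intro continuous_intros)
  have [measurable]: "d i j \<in> borel_measurable borel" for i j
    using dc by (auto intro: borel_measurable_continuous_onI)

  have R: "(\<integral>\<^sup>+x\<in>\<Omega>. (\<Sum>(i, j) | i < j. ennreal ((cmod (u x))\<^sup>2) /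
        ennreal ((particle_dist w gmult ginv x i j)\<^sup>2)) \<partial>lborel) =
      (\<Sum>(i, j) | i < j. \<integral>\<^sup>+x. ennreal (q x) / ennreal (d i j x) \<partial>lborel)" (is "?R = _")
  proof -
    have "?R = (\<integral>\<^sup>+x. (\<Sum>(i, j) | i < j. ennreal (q x) / ennreal (d i j x)) \<partial>lborel)"
    proof (rule nn_integral_cong)
      fix x
      show "(\<Sum>(i, j) | i < j. ennreal ((cmod (u x))\<^sup>2) / ennreal ((particle_dist w gmult ginv x i j)\<^sup>2))
          * indicator \<Omega> x = (\<Sum>(i, j) | i < j. ennreal (q x) / ennreal (d i j x))"
      proof (cases "x \<in> \<Omega>")
        case True
        then show ?thesis by (simp add: q[symmetric] U_def d_def)
      next
        case False
        then have "q x = 0" by (simp add: q[symmetric] U_def)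
        with False show ?thesis by (simp add: case_prod_beta)
      qed
    qed
    also have "\<dots> = (\<Sum>(i, j) | i < j. \<integral>\<^sup>+x. ennreal (q x) / ennreal (d i j x) \<partial>lborel)"
      unfolding case_prod_beta by (rule nn_integral_sum) measurable
    finally show ?thesis .
  qed

  have pair: "ennreal ((real N - 2)\<^sup>2) * (\<integral>\<^sup>+x. ennreal (q x) / ennreal (d i j x) \<partial>lborel)
      \<le> (\<integral>\<^sup>+x. ennreal (P i j x) \<partial>lborel)" if "i \<noteq> j" for i j
  proof -
    have "ennreal ((real N - 2)\<^sup>2) * (\<integral>\<^sup>+x. ennreal (q x) / ennreal (d i j x) \<partial>lborel)
      \<le> ennreal (\<integral>x. P i j x \<partial>lborel)"
    proof (rule nn_integral_singular_weight_le[OF qc dc _ _ K(1)])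
      fix e :: real assume e: "e > 0"
      have nz: "d i j x + e \<noteq> 0" for x
        using e by (simp add: d_def add_nonneg_eq_0_iff)
      have int: "integrable lborel (\<lambda>x. (v x)\<^sup>2 / (d i j x + e))"
        "integrable lborel (\<lambda>x. \<Sum>k\<in>?S. (dir_deriv v x (relative_field i j k x))\<^sup>2)"
        if v: "Ck_on 1 v UNIV" "\<And>x. x \<notin> K \<Longrightarrow> v x = 0" for v
        using nz v(2) dir_deriv_outside_support[OF K(1) v(2)]
        by (auto intro!: integrable_compact_support[OF _ K(1)] continuous_intros dc Ck1_continuous[OF v(1)]
            continuous_on_dir_deriv_along[OF v(1)] Ck1_continuous[OF Ck1_relative_field])
      have "(real N - 2)\<^sup>2 * (\<integral>x. q x / (d i j x + e) \<partial>lborel) =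
          (real N - 2)\<^sup>2 * (\<integral>x. (a x)\<^sup>2 / (d i j x + e) \<partial>lborel) +
          (real N - 2)\<^sup>2 * (\<integral>x. (b x)\<^sup>2 / (d i j x + e) \<partial>lborel)"
        using int(1)[OF a(1) aK] int(1)[OF b(1) bK]
        by (simp add: q_def add_divide_distrib distrib_left)
      also have "\<dots> \<le> (\<integral>x. (\<Sum>k\<in>?S. (dir_deriv a x (relative_field i j k x))\<^sup>2) \<partial>lborel) +
          (\<integral>x. (\<Sum>k\<in>?S. (dir_deriv b x (relative_field i j k x))\<^sup>2) \<partial>lborel)"
        unfolding d_def assms(2)
        using assms(3) unfolding assms(2)
        by (intro add_mono pair_hardy[OF that _ a(1) K(1) aK e] pair_hardy[OF that _ b(1) K(1) bK e])
      also have "\<dots> = (\<integral>x. P i j x \<partial>lborel)"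
        using int(2)[OF a(1) aK] int(2)[OF b(1) bK]
        by (simp add: P_def E_def sum.distrib)
      finally show "(real N - 2)\<^sup>2 * (\<integral>x. q x / (d i j x + e) \<partial>lborel) \<le> (\<integral>x. P i j x \<partial>lborel)" .
    qed (auto simp: q_def d_def aK bK)
    also have "\<dots> = (\<integral>\<^sup>+x. ennreal (P i j x) \<partial>lborel)"
      using P0 EK
      by (intro nn_integral_eq_integral[symmetric] integrable_compact_support[OF Pc K(1)]) (auto simp: P_def)
    finally show ?thesis .
  qed

  have PG: "(\<Sum>(i, j) | i < j. P i j x) \<le> real n * G x" for x
  proof -
    have "(\<Sum>(i, j) | i < j. P i j x) = (\<Sum>k\<in>?S. (\<Sum>(i, j) | i < j. E x (relative_field i j k x)))"
      unfolding P_def case_prod_beta by (rule sum.swap)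
    also have "\<dots> \<le> (\<Sum>k\<in>?S. real n * (\<Sum>i\<in>UNIV. E x (axis i (X k (x $ i)))))"
    proof (rule sum_mono)
      fix k
      have lin: "dir_deriv f x (relative_field i j k x) =
          dir_deriv f x (axis i (X k (x $ i))) - dir_deriv f x (axis j (X k (x $ j)))"
        if "Ck_on 1 f UNIV" for f :: "(real ^ 'd) ^ 'n::{finite,linorder} \<Rightarrow> real" and i j
        unfolding relative_field_def using linear_diff[OF dir_deriv_linear[OF that]] .
      have "(\<Sum>(i, j) | i < j. E x (relative_field i j k x)) =
         (\<Sum>(i, j) | i < j. (dir_deriv a x (axis i (X k (x $ i))) - dir_deriv a x (axis j (X k (x $ j))))\<^sup>2) +
         (\<Sum>(i, j) | i < j. (dir_deriv b x (axis i (X k (x $ i))) - dir_deriv b x (axis j (X k (x $ j))))\<^sup>2)"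
        unfolding E_def lin[OF a(1)] lin[OF b(1)] by (simp add: case_prod_beta sum.distrib)
      also have "\<dots> \<le> real n * (\<Sum>i\<in>UNIV. (dir_deriv a x (axis i (X k (x $ i))))\<^sup>2) +
          real n * (\<Sum>i\<in>UNIV. (dir_deriv b x (axis i (X k (x $ i))))\<^sup>2)"
        unfolding assms(4) by (intro add_mono sum_pairs_diff_sq_le)
      also have "\<dots> = real n * (\<Sum>i\<in>UNIV. E x (axis i (X k (x $ i))))"
        by (simp add: E_def sum.distrib distrib_left)
      finally show "(\<Sum>(i, j) | i < j. E x (relative_field i j k x)) \<le>
          real n * (\<Sum>i\<in>UNIV. E x (axis i (X k (x $ i))))" .
    qed
    also have "\<dots> = real n * G x"
      unfolding G_def sum_distrib_left[symmetric] by (subst sum.swap) simp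
    finally show ?thesis .
  qed

  have "ennreal ((real N - 2)\<^sup>2) * ?R =
      (\<Sum>(i, j) | i < j. ennreal ((real N - 2)\<^sup>2) * (\<integral>\<^sup>+x. ennreal (q x) / ennreal (d i j x) \<partial>lborel))"
    unfolding R by (simp add: sum_distrib_left case_prod_beta)
  also have "\<dots> \<le> (\<Sum>(i, j) | i < j. \<integral>\<^sup>+x. ennreal (P i j x) \<partial>lborel)"
    by (rule sum_mono) (auto intro!: pair)
  also have "\<dots> = (\<integral>\<^sup>+x. (\<Sum>(i, j) | i < j. ennreal (P i j x)) \<partial>lborel)"
    unfolding case_prod_beta by (rule nn_integral_sum[symmetric]) measurable
  also have "\<dots> \<le> (\<integral>\<^sup>+x. ennreal (real n) * ennreal (G x) \<partial>lborel)"
  proof (rule nn_integral_mono)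
    fix x
    have "(\<Sum>(i, j) | i < j. ennreal (P i j x)) = ennreal (\<Sum>(i, j) | i < j. P i j x)"
      using P0 by (simp add: case_prod_beta sum_ennreal)
    also have "\<dots> \<le> ennreal (real n * G x)" by (rule ennreal_leI[OF PG])
    also have "\<dots> = ennreal (real n) * ennreal (G x)" using G0 by (simp add: ennreal_mult)
    finally show "(\<Sum>(i, j) | i < j. ennreal (P i j x)) \<le> ennreal (real n) * ennreal (G x)" .
  qed
  also have "\<dots> = ennreal (real n) * (\<integral>\<^sup>+x. ennreal (G x) \<partial>lborel)"
    by (rule nn_integral_cmult) measurable
  finally have le: "ennreal ((real N - 2)\<^sup>2) * ?R \<le> ennreal (real n) * (\<integral>\<^sup>+x. ennreal (G x) \<partial>lborel)" .
  have "ennreal ((real N - 2)\<^sup>2 / real n) * ?R = ennreal (1 / real n) * (ennreal ((real N - 2)\<^sup>2) * ?R)"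
    by (simp add: mult.assoc[symmetric] ennreal_mult[symmetric])
  also have "\<dots> \<le> ennreal (1 / real n) * (ennreal (real n) * (\<integral>\<^sup>+x. ennreal (G x) \<partial>lborel))"
    by (rule mult_left_mono[OF le]) simp
  also have "\<dots> = (\<integral>\<^sup>+x. ennreal (G x) \<partial>lborel)"
    using assms(5) by (simp add: mult.assoc[symmetric] ennreal_mult[symmetric])
  finally show ?thesis unfolding L .
qed

end
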